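(* Let $n\ge 2$, let $K=[0,\infty)^n\subset\mathbb{R}^n$ be the non-negative orthant with standard basis vectors $e_1,\dots,e_n$, and let $A=(a_1,\dots,a_n)$ be a point of the interior $K^o$ (i.e. all $a_i>0$). Set $b_i=\frac{n-1}{2}a_i$ for $1\le i\le n$, let $\lambda_A$ be the unique real root (which is positive) of the equation $f_A(x)=0$ on $[-\min_i b_i^2,\infty)$, where $$f_A(x)=\sum_{i=1}^n\frac{b_i}{b_i+\sqrt{b_i^2+x}}-\frac{n-1}{2},$$ and set $c_i=b_i+\sqrt{b_i^2+\lambda_A}$ for $1\le i\le n$. Then there exists a unique stationary hyperplane for $A$. Moreover, if $A_i$ denotes the point of intersection of this hyperplane with the ray $\{te_i:t\ge 0\}$ and $\mathcal{A}=A_1A_2\dots A_n$ is the corresponding $(n-1)$-simplex, then $\overrightarrow{OA_i}=c_ie_i$ for $1\le i\le n$, and the $(n-1)$-volume of $\mathcal{A}$ is $$V_{n-1}(\mathcal{A})=\frac{\prod_{i=1}^n c_i}{(n-1)!\sqrt{\lambda_A}}.$$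
   Context: $(\cdot,\cdot)$ is the standard inner product in $\mathbb{R}^n$ and $O$ is the origin. For a closed convex pointed cone $K\subset\mathbb{R}^n$ with vertex $O$ and non-empty interior, the dual cone is $K^*=\{y:(y,x)\ge 0\ \forall x\in K\}$, and $K^+=(K^* )^o$ is its interior. For $b\ne 0$ let $\mathcal{H}(b)=\{x\in\mathbb{R}^n:(b,x)=1\}$, $K(b)=K\cap\mathcal{H}(b)$, and let $V(b)$ be the $(n-1)$-volume of $K(b)$. The hyperplane $\mathcal{H}(b)$ is called admissible if $b\in K^+$ (equivalently, $V(b)$ is finite and $K(b)$ is compact). For a point $A$ with position vector $a=\overrightarrow{OA}$, an admissible hyperplane $\mathcal{H}(b)$ containing $A$ (i.e. $(b,a)=1$) is called a stationary hyperplane for $A$ if $b$ is a stationary point of $V$ under the constraint $(b,a)=1$, i.e. the gradient of $V$ at $b$ equals $\lambda a$ for some real $\lambda$. It is a known result that this is equivalent to $\overrightarrow{AH}=n\overrightarrow{AG}$, where $H$ is the orthogonal projection of $O$ on $\mathcal{H}(b)$ and $G$ is the centroid of $K(b)$. The function $f_A$ is continuous and strictly decreasing on $[-\min_i b_i^2,\infty)$ with $f_A(0)=\frac12$ and limit $\frac{1-n}{2}$ at $+\infty$, so $\lambda_A$ is well defined and positive. *)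

theory Defs
  imports "HOL-Analysis.Analysis"
begin

(* Lebesgue measure on the affine subspace E, of dimension aff_dim E: the image of the product
   Lebesgue measure under coordinates given by an origin p in E and an orthonormal basis B of the
   direction space of E (for E = UNIV and B = Basis this is how lborel itself is built).  By
   invariance of Lebesgue measure under isometries the choices of p and B are immaterial. *)

definition direction_space :: "'a::euclidean_space set \<Rightarrow> 'a set" where
  "direction_space E = {x - y | x y. x \<in> E \<and> y \<in> E}"

definition orthonormal_basis_of :: "'a::euclidean_space set \<Rightarrow> 'a set \<Rightarrow> bool" where
  "orthonormal_basis_of S B \<longleftrightarrow>
     pairwise orthogonal B \<and> (\<forall>u\<in>B. norm u = 1) \<and> span B = S"

definition affine_lborel :: "'a::euclidean_space set \<Rightarrow> 'a measure" where
  "affine_lborel E =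
     (let p = (SOME p. p \<in> E);
          B = (SOME B. orthonormal_basis_of (direction_space E) B)
      in distr (\<Pi>\<^sub>M u\<in>B. lborel) borel (\<lambda>f. p + (\<Sum>u\<in>B. f u *\<^sub>R u)))"

definition dual_cone :: "'a::real_inner set \<Rightarrow> 'a set" where
  "dual_cone K = {y. \<forall>x\<in>K. y \<bullet> x \<ge> 0}"

definition hyperplane :: "'a::real_inner \<Rightarrow> 'a set" where
  "hyperplane b = {x. b \<bullet> x = 1}"

definition section_volume :: "'a::euclidean_space set \<Rightarrow> 'a \<Rightarrow> real" where
  "section_volume K b = measure (affine_lborel (hyperplane b)) (K \<inter> hyperplane b)"

(* The value of section_volume is 0 (by convention of measure) where the volume is infinite.  This
   does not affect the gradient below, since it is only taken at points of the open set
   interior (dual_cone K), on which the volume is finite. *)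

definition stationary_hyperplane :: "'a::euclidean_space set \<Rightarrow> 'a \<Rightarrow> 'a set \<Rightarrow> bool" where
  "stationary_hyperplane K a H \<longleftrightarrow>
     (\<exists>b. H = hyperplane b \<and> b \<in> interior (dual_cone K) \<and> b \<bullet> a = 1 \<and>
          (\<exists>l. GDERIV (section_volume K) b :> l *\<^sub>R a))"

definition orthant :: "(real^'n) set" where
  "orthant = {x. \<forall>i. 0 \<le> x $ i}"

definition b_coeff :: "real^'n \<Rightarrow> 'n \<Rightarrow> real" where
  "b_coeff a i = (real CARD('n) - 1) / 2 * a $ i"

definition f_fun :: "real^'n \<Rightarrow> real \<Rightarrow> real" where
  "f_fun a x =
     (\<Sum>i\<in>UNIV. b_coeff a i / (b_coeff a i + sqrt ((b_coeff a i)\<^sup>2 + x)))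
       - (real CARD('n) - 1) / 2"

definition f_dom :: "real^'n \<Rightarrow> real set" where
  "f_dom a = {- Min (range (\<lambda>i. (b_coeff a i)\<^sup>2))..}"

definition lambda_root :: "real^'n \<Rightarrow> real" where
  "lambda_root a = (THE x. x \<in> f_dom a \<and> f_fun a x = 0)"

definition c_coeff :: "real^'n \<Rightarrow> 'n \<Rightarrow> real" where
  "c_coeff a i = b_coeff a i + sqrt ((b_coeff a i)\<^sup>2 + lambda_root a)"

lemma interior_orthant: "interior (orthant :: (real^'n) set) = {x. \<forall>i. 0 < x $ i}"
proof -
  have "interior {x::real^'n. \<forall>i. 0 \<le> x $ i} = {x. \<forall>i. 0 < x $ i}"
  proof (rule interior_unique)
    show "{x::real^'n. \<forall>i. 0 < x $ i} \<subseteq> {x. \<forall>i. 0 \<le> x $ i}"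
      by (auto intro: less_imp_le)
    have "{x::real^'n. \<forall>i. 0 < x $ i} = (\<Inter>i. {x. 0 < x $ i})" by auto
    moreover have "open (\<Inter>i. {x::real^'n. 0 < x $ i})"
      by (intro open_INT ballI open_Collect_less continuous_intros) auto
    ultimately show "open {x::real^'n. \<forall>i. 0 < x $ i}" by simp
  next
    fix T :: "(real^'n) set" assume T: "T \<subseteq> {x. \<forall>i. 0 \<le> x $ i}" "open T"
    show "T \<subseteq> {x. \<forall>i. 0 < x $ i}"
    proof safe
      fix x i assume "x \<in> T"
      then obtain e where e: "e > 0" "cball x e \<subseteq> T" using T(2) open_contains_cball by blast
      have "x - e *\<^sub>R axis i 1 \<in> cball x e" using e by (simp add: dist_norm)
      then have "0 \<le> (x - e *\<^sub>R axis i 1) $ i" using e T(1) by blast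
      then show "0 < x $ i" using e by (simp add: axis_def)
    qed
  qed
  then show ?thesis by (simp add: orthant_def)
qed

lemma f_fun_strict_antimono:
  fixes a :: "real^'n"
  assumes n: "CARD('n) \<ge> 2" and a: "\<And>i. 0 < a $ i"
    and x: "x \<in> f_dom a" and xy: "x < y"
  shows "f_fun a y < f_fun a x"
proof -
  have b: "0 < b_coeff a i" for i using n a[of i] by (simp add: b_coeff_def)
  have d: "0 \<le> (b_coeff a i)\<^sup>2 + x" for i
  proof -
    have "Min (range (\<lambda>i. (b_coeff a i)\<^sup>2)) \<le> (b_coeff a i)\<^sup>2" by (intro Min_le) auto
    then show ?thesis using x unfolding f_dom_def atLeast_iff by linarith
  qed
  have "(\<Sum>i\<in>UNIV. b_coeff a i / (b_coeff a i + sqrt ((b_coeff a i)\<^sup>2 + y)))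
      < (\<Sum>i\<in>UNIV. b_coeff a i / (b_coeff a i + sqrt ((b_coeff a i)\<^sup>2 + x)))"
  proof (rule sum_strict_mono)
    fix i
    have "sqrt ((b_coeff a i)\<^sup>2 + x) < sqrt ((b_coeff a i)\<^sup>2 + y)" using xy by simp
    moreover have "0 \<le> sqrt ((b_coeff a i)\<^sup>2 + x)" using d[of i] by simp
    ultimately show "b_coeff a i / (b_coeff a i + sqrt ((b_coeff a i)\<^sup>2 + y))
      < b_coeff a i / (b_coeff a i + sqrt ((b_coeff a i)\<^sup>2 + x))"
      using b[of i] by (intro divide_strict_left_mono mult_pos_pos add_pos_nonneg) linarith+
  qed auto
  then show ?thesis by (simp add: f_fun_def)
qed

lemma lambda_root:
  fixes a :: "real^'n"
  assumes n: "CARD('n) \<ge> 2" and a: "a \<in> interior orthant"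
  shows "\<exists>!x. x \<in> f_dom a \<and> f_fun a x = 0"
    and "lambda_root a \<in> f_dom a" and "f_fun a (lambda_root a) = 0" and "0 < lambda_root a"
proof -
  have a: "0 < a $ i" for i using a by (simp add: interior_orthant)
  have b: "0 < b_coeff a i" for i using n a[of i] by (simp add: b_coeff_def)
  define X where "X = 8 * (\<Sum>i\<in>UNIV. (b_coeff a i)\<^sup>2)"
  have X0: "X \<ge> 0" unfolding X_def by (simp add: sum_nonneg)
  have f0: "f_fun a 0 = 1/2"
  proof -
    have "b_coeff a i / (b_coeff a i + sqrt ((b_coeff a i)\<^sup>2 + 0)) = 1/2" for i
      using b[of i] by (simp add: field_simps)
    then have "f_fun a 0 = real CARD('n) * (1/2) - (real CARD('n) - 1) / 2"
      unfolding f_fun_def by (simp only: sum_constant)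
    then show ?thesis by (simp add: field_simps)
  qed
  have fX: "f_fun a X \<le> 0"
  proof -
    have "b_coeff a i / (b_coeff a i + sqrt ((b_coeff a i)\<^sup>2 + X)) \<le> 1/4" for i
    proof -
      have "(b_coeff a i)\<^sup>2 \<le> (\<Sum>i\<in>UNIV. (b_coeff a i)\<^sup>2)" by (intro member_le_sum) auto
      then have "(3 * b_coeff a i)\<^sup>2 \<le> (b_coeff a i)\<^sup>2 + X" by (simp add: X_def power_mult_distrib)
      then have "3 * b_coeff a i \<le> sqrt ((b_coeff a i)\<^sup>2 + X)" by (rule real_le_rsqrt)
      then show ?thesis using b[of i] by (subst divide_le_eq) (auto; linarith)
    qed
    then have "(\<Sum>i\<in>UNIV. b_coeff a i / (b_coeff a i + sqrt ((b_coeff a i)\<^sup>2 + X)))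
        \<le> of_nat (card (UNIV :: 'n set)) * (1/4)" by (intro sum_bounded_above) simp
    then show ?thesis using n by (simp add: f_fun_def)
  qed
  have pos: "b_coeff a i + sqrt ((b_coeff a i)\<^sup>2 + x) \<noteq> 0" if "0 \<le> x" for i x
    using b[of i] that by (smt (verit) real_sqrt_ge_zero zero_le_power2)
  have "continuous_on {0..X} (f_fun a)" unfolding f_fun_def
    by (intro continuous_intros) (use pos in auto)
  then obtain z where z: "0 \<le> z" "z \<le> X" "f_fun a z = 0"
    using IVT2'[of "f_fun a" X 0 0] f0 fX X0 by auto
  have z0: "0 < z" using z f0 by (cases "z = 0") auto
  have zd: "z \<in> f_dom a"
  proof -
    have "0 \<le> Min (range (\<lambda>i. (b_coeff a i)\<^sup>2))" by (subst Min_ge_iff) auto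
    then show ?thesis using z(1) unfolding f_dom_def atLeast_iff by linarith
  qed
  have uniq: "y = z" if y: "y \<in> f_dom a" "f_fun a y = 0" for y
  proof (cases y z rule: linorder_cases)
    case less
    from f_fun_strict_antimono[OF n a y(1) less] show ?thesis using y(2) z(3) by simp
  next
    case greater
    from f_fun_strict_antimono[OF n a zd greater] show ?thesis using y(2) z(3) by simp
  qed
  have l: "lambda_root a = z"
    unfolding lambda_root_def by (rule the_equality) (use zd z(3) uniq in blast)+
  show "\<exists>!x. x \<in> f_dom a \<and> f_fun a x = 0"
    by (rule ex1I[of _ z]) (use zd z(3) uniq in blast)+
  show "lambda_root a \<in> f_dom a" "f_fun a (lambda_root a) = 0" "0 < lambda_root a"
    using zd z(3) z0 unfolding l by blast+
qed

end

theory Submission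
  imports Defs
begin

text \<open>Below \<open>b\<close> is the normal vector of a hyperplane, not the coefficients of \<open>b_coeff\<close>.
  Slicing the truncated cone \<open>{x \<in> K. (b, x) \<le> 1}\<close> by hyperplanes parallel to its base shows that
  its volume is \<open>V(b) / (n |b|)\<close>. For the orthant it is also \<open>1 / (n! b\<^sub>1 \<dots> b\<^sub>n)\<close>, hence
  \<open>V(b) = |b| / ((n - 1)! b\<^sub>1 \<dots> b\<^sub>n)\<close>. The gradient of \<open>V\<close> has the components
  \<open>V(b) (b\<^sub>i / |b|\<^sup>2 - 1 / b\<^sub>i)\<close>; pairing it with \<open>b\<close> identifies the Lagrange multiplier as
  \<open>(1 - n) V(b)\<close>. With \<open>c\<^sub>i = 1 / b\<^sub>i\<close> and \<open>\<lambda> = 1 / |b|\<^sup>2\<close> stationarity thus becomes the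
  quadratic equation \<open>c\<^sub>i\<^sup>2 = (n - 1) a\<^sub>i c\<^sub>i + \<lambda>\<close>, and the constraint \<open>(b, a) = 1\<close> becomes
  \<open>f\<^sub>A(\<lambda>) = 0\<close>. Conversely, summing the quadratic equations divided by \<open>c\<^sub>i\<^sup>2\<close> recovers
  \<open>|b|\<^sup>2 = 1 / \<lambda>\<close> at the root.\<close>

subsection \<open>Lebesgue measure in orthonormal coordinates\<close>

text \<open>By induction on \<open>B\<close>: Fubini splits off one coordinate, and the
  one-dimensional substitution rule contributes one factor \<open>\<bar>c\<bar>\<close>. A separate
  shift \<open>s i\<close> per coordinate and a common scale \<open>c\<close> cover translations and
  homotheties.\<close>

lemma nn_integral_PiM_lborel_affine:
  fixes s :: "'i \<Rightarrow> real" and c :: real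
  assumes "finite B" and "c \<noteq> 0" and "f \<in> borel_measurable (\<Pi>\<^sub>M i\<in>B. lborel)"
  shows "(\<integral>\<^sup>+x. f x \<partial>(\<Pi>\<^sub>M i\<in>B. lborel)) =
    ennreal (\<bar>c\<bar> ^ card B) * (\<integral>\<^sup>+x. f (\<lambda>i\<in>B. s i + c * x i) \<partial>(\<Pi>\<^sub>M i\<in>B. lborel))"
  using assms(1,3)
proof (induction B arbitrary: f rule: finite_induct)
  case empty
  interpret product_sigma_finite "\<lambda>_::'i. lborel :: real measure" by standard
  show ?case by (simp add: PiM_empty nn_integral_count_space_finite)
next
  case (insert b A)
  interpret product_sigma_finite "\<lambda>_::'i. lborel :: real measure" by standard
  interpret A: sigma_finite_measure "\<Pi>\<^sub>M i\<in>A. (lborel :: real measure)"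
    by (rule sigma_finite[OF insert.hyps(1)])
  note [measurable] = insert.prems
  let ?T = "\<lambda>A x. (\<lambda>i\<in>A. s i + c * x i)"
  have T[measurable]: "?T A \<in> measurable (\<Pi>\<^sub>M i\<in>A. lborel) (\<Pi>\<^sub>M i\<in>A. lborel)" for A
    by measurable
  have G[measurable]: "(\<lambda>y. \<integral>\<^sup>+ x. f ((?T A x)(b := y)) \<partial>(\<Pi>\<^sub>M i\<in>A. lborel)) \<in> borel_measurable borel"
    by measurable
  have "(\<integral>\<^sup>+x. f x \<partial>(\<Pi>\<^sub>M i\<in>insert b A. lborel)) =
      (\<integral>\<^sup>+y. \<integral>\<^sup>+x. f (x(b := y)) \<partial>(\<Pi>\<^sub>M i\<in>A. lborel) \<partial>lborel)"
    using insert by (intro product_nn_integral_insert_rev) auto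
  also have "\<dots> = (\<integral>\<^sup>+y. ennreal (\<bar>c\<bar> ^ card A) *
      (\<integral>\<^sup>+x. f ((?T A x)(b := y)) \<partial>(\<Pi>\<^sub>M i\<in>A. lborel)) \<partial>lborel)"
    by (intro nn_integral_cong insert.IH) measurable
  also have "\<dots> = ennreal (\<bar>c\<bar> ^ card A) *
      (\<integral>\<^sup>+y. (\<integral>\<^sup>+x. f ((?T A x)(b := y)) \<partial>(\<Pi>\<^sub>M i\<in>A. lborel)) \<partial>lborel)"
    by (rule nn_integral_cmult) measurable
  also have "\<dots> = ennreal (\<bar>c\<bar> ^ card A) * (ennreal \<bar>c\<bar> *
      (\<integral>\<^sup>+y. (\<integral>\<^sup>+x. f ((?T A x)(b := s b + c * y)) \<partial>(\<Pi>\<^sub>M i\<in>A. lborel)) \<partial>lborel))"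
    by (subst nn_integral_real_affine[OF G \<open>c \<noteq> 0\<close>, of "s b"]) simp
  also have "(\<integral>\<^sup>+y. (\<integral>\<^sup>+x. f ((?T A x)(b := s b + c * y)) \<partial>(\<Pi>\<^sub>M i\<in>A. lborel)) \<partial>lborel) =
      (\<integral>\<^sup>+y. (\<integral>\<^sup>+x. f (?T (insert b A) (x(b := y))) \<partial>(\<Pi>\<^sub>M i\<in>A. lborel)) \<partial>lborel)"
    using insert.hyps
    by (intro nn_integral_cong arg_cong[where f = f]) (auto simp: fun_eq_iff restrict_def)
  also have "\<dots> = (\<integral>\<^sup>+x. f (?T (insert b A) x) \<partial>(\<Pi>\<^sub>M i\<in>insert b A. lborel))"
    using insert.hyps by (intro product_nn_integral_insert_rev[symmetric]) auto
  finally show ?case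
    by (simp only: card_insert_disjoint[OF insert.hyps] power_Suc ennreal_mult' abs_ge_zero mult_ac)
qed

lemma measurable_linear_combination [measurable]:
  "(\<lambda>f. \<Sum>v\<in>B. f v *\<^sub>R v) \<in> borel_measurable (\<Pi>\<^sub>M v\<in>(B :: 'a::euclidean_space set). lborel)"
  by measurable

text \<open>The substitution rule in terms of vectors of \<open>span B\<close>. The case
  \<open>c = 1\<close> gives translation invariance of Lebesgue measure in orthonormal coordinates;
  general \<open>c\<close> compares parallel slices of a cone.\<close>

lemma nn_integral_linear_combination_affine:
  fixes B :: "'a::euclidean_space set"
  assumes B: "finite B" and w: "w \<in> span B" and c: "c \<noteq> 0"
    and [measurable]: "g \<in> borel_measurable borel"
  shows "(\<integral>\<^sup>+x. g (\<Sum>v\<in>B. x v *\<^sub>R v) \<partial>(\<Pi>\<^sub>M v\<in>B. lborel)) =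
    ennreal (\<bar>c\<bar> ^ card B) * (\<integral>\<^sup>+x. g (w + c *\<^sub>R (\<Sum>v\<in>B. x v *\<^sub>R v)) \<partial>(\<Pi>\<^sub>M v\<in>B. lborel))"
proof -
  obtain s where s: "w = (\<Sum>v\<in>B. s v *\<^sub>R v)"
    using w span_finite[OF B] by auto
  have "(\<Sum>v\<in>B. (\<lambda>i\<in>B. s i + c * x i) v *\<^sub>R v) = w + c *\<^sub>R (\<Sum>v\<in>B. x v *\<^sub>R v)" for x
    by (simp add: s sum.distrib scaleR_add_left scaleR_sum_right)
  then show ?thesis
    by (subst nn_integral_PiM_lborel_affine[OF B c, where s = s]) auto
qed

text \<open>Both sides compute the integral of \<open>indicator A (x + y) * indicator B y\<close> over
  \<open>\<mu> \<times> lborel\<close>.\<close>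

lemma translation_invariant_emeasure_lborel:
  fixes \<mu> :: "'a::euclidean_space measure"
  assumes "sigma_finite_measure \<mu>" and sets: "sets \<mu> = sets borel"
    and inv: "\<And>t A. A \<in> sets borel \<Longrightarrow> emeasure \<mu> {x. t + x \<in> A} = emeasure \<mu> A"
    and [measurable]: "A \<in> sets borel" "B \<in> sets borel"
  shows "emeasure \<mu> A * emeasure lborel B = emeasure \<mu> {x. - x \<in> B} * emeasure lborel A"
proof -
  interpret \<mu>: sigma_finite_measure \<mu> by fact
  interpret pair_sigma_finite lborel \<mu> ..
  note [measurable_cong] = sets
  have *: "emeasure lborel A = emeasure lborel {y. x + y \<in> A}" if "A \<in> sets borel" for x and A :: "'a set"
  proof -
    have "emeasure (distr lborel borel ((+) x)) A = emeasure lborel {y. x + y \<in> A}"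
      using that by (subst emeasure_distr) (auto intro!: arg_cong[where f = "emeasure lborel"])
    then show ?thesis by (simp add: lborel_distr_plus)
  qed
  have "emeasure \<mu> A * emeasure lborel B = (\<integral>\<^sup>+y. emeasure \<mu> A * indicator B y \<partial>lborel)"
    by (rule nn_integral_cmult_indicator[symmetric]) simp
  also have "\<dots> = (\<integral>\<^sup>+y. emeasure \<mu> {x. y + x \<in> A} * indicator B y \<partial>lborel)"
    by (simp add: inv)
  also have "\<dots> = (\<integral>\<^sup>+y. (\<integral>\<^sup>+x. indicator A (y + x) * indicator B y \<partial>\<mu>) \<partial>lborel)"
  proof (rule nn_integral_cong)
    fix y
    have "emeasure \<mu> {x. y + x \<in> A} = (\<integral>\<^sup>+x. indicator {x. y + x \<in> A} x \<partial>\<mu>)"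
      by simp
    also have "\<dots> = (\<integral>\<^sup>+x. indicator A (y + x) \<partial>\<mu>)"
      by (intro nn_integral_cong) (simp add: indicator_def)
    finally show "emeasure \<mu> {x. y + x \<in> A} * indicator B y = (\<integral>\<^sup>+x. indicator A (y + x) * indicator B y \<partial>\<mu>)"
      by (simp add: nn_integral_multc)
  qed
  also have "\<dots> = (\<integral>\<^sup>+x. (\<integral>\<^sup>+y. indicator A (y + x) * indicator B y \<partial>lborel) \<partial>\<mu>)"
    by (rule Fubini'[symmetric]) measurable
  \<comment> \<open>For fixed \<open>x\<close>, substitute \<open>z = y + x\<close>, using the
    translation invariance of \<open>lborel\<close>.\<close>
  also have "\<dots> = (\<integral>\<^sup>+x. (\<integral>\<^sup>+z. indicator A z * indicator B (z - x) \<partial>lborel) \<partial>\<mu>)"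
  proof (rule nn_integral_cong)
    fix x
    have "(\<integral>\<^sup>+z. indicator A z * indicator B (z - x) \<partial>distr lborel borel ((+) x)) =
      (\<integral>\<^sup>+y. indicator A (y + x) * indicator B y \<partial>(lborel :: 'a measure))"
      by (subst nn_integral_distr) (auto simp: add.commute)
    then show "(\<integral>\<^sup>+y. indicator A (y + x) * indicator B y \<partial>lborel) =
        (\<integral>\<^sup>+z. indicator A z * indicator B (z - x) \<partial>(lborel :: 'a measure))"
      by (simp add: lborel_distr_plus)
  qed
  also have "\<dots> = (\<integral>\<^sup>+z. (\<integral>\<^sup>+x. indicator A z * indicator B (z - x) \<partial>\<mu>) \<partial>lborel)"
    by (rule Fubini') measurable
  also have "\<dots> = (\<integral>\<^sup>+z. emeasure \<mu> {x. - x \<in> B} * indicator A z \<partial>lborel)"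
  proof (rule nn_integral_cong)
    fix z
    have B': "{x. - x \<in> B} \<in> sets borel" by measurable
    \<comment> \<open>Now the invariance of \<open>\<mu>\<close> is used again:
      \<open>- (- z + x) = z - x\<close>.\<close>
    have "emeasure \<mu> {x. - x \<in> B} = emeasure \<mu> {x. z - x \<in> B}"
      using inv[OF B', of "- z"] by simp
    also have "\<dots> = (\<integral>\<^sup>+x. indicator {x. z - x \<in> B} x \<partial>\<mu>)" by simp
    also have "\<dots> = (\<integral>\<^sup>+x. indicator B (z - x) \<partial>\<mu>)"
      by (intro nn_integral_cong) (simp add: indicator_def)
    finally show "(\<integral>\<^sup>+x. indicator A z * indicator B (z - x) \<partial>\<mu>) = emeasure \<mu> {x. - x \<in> B} * indicator A z"
      by (simp add: nn_integral_cmult mult.commute)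
  qed
  also have "\<dots> = emeasure \<mu> {x. - x \<in> B} * emeasure lborel A"
    by (rule nn_integral_cmult_indicator) simp
  finally show ?thesis .
qed

lemma orthonormal_basis_of_finite: "orthonormal_basis_of S B \<Longrightarrow> finite B"
  by (auto simp: orthonormal_basis_of_def intro: pairwise_orthogonal_imp_finite)

lemma orthonormal_basis_of_independent: "orthonormal_basis_of S B \<Longrightarrow> independent B"
  unfolding orthonormal_basis_of_def by (metis norm_zero pairwise_orthogonal_independent zero_neq_one)

lemma norm_orthonormal_combination:
  assumes "orthonormal_basis_of S B"
  shows "norm (\<Sum>v\<in>B. f v *\<^sub>R v) = sqrt (\<Sum>v\<in>B. (f v)\<^sup>2)"
proof -
  have "(norm (\<Sum>v\<in>B. f v *\<^sub>R v))\<^sup>2 = (\<Sum>v\<in>B. (norm (f v *\<^sub>R v))\<^sup>2)"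
    using assms
    by (intro norm_sum_Pythagorean[OF orthonormal_basis_of_finite[OF assms]])
      (auto simp: orthonormal_basis_of_def pairwise_def orthogonal_clauses)
  also have "\<dots> = (\<Sum>v\<in>B. (f v)\<^sup>2)"
    using assms by (intro sum.cong) (auto simp: orthonormal_basis_of_def)
  finally show ?thesis by (metis norm_ge_zero real_sqrt_unique)
qed

text \<open>The image measure is translation invariant, so the preceding identity with the unit ball
  in the role of \<open>B\<close> makes it proportional to \<open>lborel\<close>. The factor is 1
  because both measures agree on the ball, which is symmetric under negation. This allows Fubini in
  coordinates adapted to a hyperplane.\<close>

lemma lborel_eq_distr_orthonormal:
  fixes B :: "'a::euclidean_space set"
  assumes B: "orthonormal_basis_of UNIV B"
  shows "distr (\<Pi>\<^sub>M v\<in>B. lborel) borel (\<lambda>f. \<Sum>v\<in>B. f v *\<^sub>R v) = lborel" (is "?\<mu> = _")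
proof -
  note fin = orthonormal_basis_of_finite[OF B]
  have span: "span B = UNIV" using B by (simp add: orthonormal_basis_of_def)
  have card: "card B = DIM('a)"
    using orthonormal_basis_of_independent[OF B] span
    by (metis dim_UNIV dim_eq_card_independent dim_span)
  \<comment> \<open>By Pythagoras the preimage of a ball is the Euclidean ball in coordinate space,
    whose volume depends only on the number of coordinates.\<close>
  have ball: "emeasure ?\<mu> (cball 0 r) = emeasure lborel (cball (0::'a) r)" if r: "r > 0" for r
  proof -
    have "emeasure ?\<mu> (cball 0 r) = emeasure (\<Pi>\<^sub>M v\<in>B. lborel)
        ({f. sqrt (\<Sum>v\<in>B. (f v)\<^sup>2) \<le> r} \<inter> space (\<Pi>\<^sub>M v\<in>B. lborel))"
      by (subst emeasure_distr)
        (auto simp: norm_orthonormal_combination[OF B] intro!: arg_cong[where f = "emeasure _"])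
    also have "\<dots> = emeasure lborel (cball (0::'a) r)"
      using r by (simp add: emeasure_cball_aux[OF fin] emeasure_cball card)
    finally show ?thesis .
  qed
  have inv: "emeasure ?\<mu> {x. t + x \<in> A} = emeasure ?\<mu> A" if [measurable]: "A \<in> sets borel" for t A
  proof -
    have [measurable]: "{x. t + x \<in> A} \<in> sets borel" by measurable
    have "emeasure ?\<mu> {x. t + x \<in> A} = (\<integral>\<^sup>+x. indicator {x. t + x \<in> A} x \<partial>?\<mu>)"
      by simp
    also have "\<dots> = (\<integral>\<^sup>+x. indicator A (t + 1 *\<^sub>R (\<Sum>v\<in>B. x v *\<^sub>R v)) \<partial>(\<Pi>\<^sub>M v\<in>B. lborel))"
      by (subst nn_integral_distr) (auto simp: indicator_def intro!: nn_integral_cong)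
    also have "\<dots> = (\<integral>\<^sup>+x. indicator A (\<Sum>v\<in>B. x v *\<^sub>R v) \<partial>(\<Pi>\<^sub>M v\<in>B. lborel))"
      using nn_integral_linear_combination_affine[OF fin, of t 1 "indicator A"] span by simp
    also have "\<dots> = emeasure ?\<mu> A"
      by (subst nn_integral_distr[symmetric, where M' = borel and f = "indicator A"]) auto
    finally show ?thesis .
  qed
  have sf: "sigma_finite_measure ?\<mu>"
  proof
    have "\<Union> (range (\<lambda>n. cball (0::'a) (real (Suc n)))) = UNIV"
    proof (intro subset_antisym subset_UNIV subsetI)
      fix x :: 'a
      obtain n where "norm x < real n" using reals_Archimedean2 by blast
      then show "x \<in> \<Union> (range (\<lambda>n. cball 0 (real (Suc n))))"
        by (intro UN_I[of n]) auto
    qed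
    then show "\<exists>A. countable A \<and> A \<subseteq> sets ?\<mu> \<and> \<Union> A = space ?\<mu> \<and> (\<forall>a\<in>A. emeasure ?\<mu> a \<noteq> \<infinity>)"
      by (intro exI[of _ "range (\<lambda>n. cball 0 (real (Suc n)))"])
        (auto simp: ball emeasure_cball simp del: of_nat_Suc)
  qed
  show ?thesis
  proof (rule measure_eqI)
    fix A assume "A \<in> sets ?\<mu>"
    then have A: "A \<in> sets borel" by simp
    let ?c = "emeasure lborel (cball (0::'a) 1)"
    have "emeasure ?\<mu> A * ?c = emeasure ?\<mu> {x. - x \<in> cball 0 1} * emeasure lborel A"
      by (rule translation_invariant_emeasure_lborel[OF sf _ inv A]) auto
    also have "{x. - x \<in> cball 0 1} = cball (0::'a) 1" by auto
    finally have "?c * emeasure ?\<mu> A = ?c * emeasure lborel A"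
      by (simp add: ball mult.commute)
    \<comment> \<open>Cancellation in \<open>ennreal\<close> requires a factor that is neither 0 nor
      infinite.\<close>
    moreover have "?c \<noteq> 0" "?c \<noteq> top"
      by (simp_all add: emeasure_cball ennreal_eq_0_iff not_le)
    ultimately show "emeasure ?\<mu> A = emeasure lborel A"
      by (simp add: ennreal_mult_cancel_left)
  qed simp
qed

subsection \<open>Volume of hyperplane sections\<close>

lemma direction_space_hyperplane:
  fixes b :: "'a::euclidean_space"
  assumes "b \<noteq> 0"
  shows "direction_space (hyperplane b) = {x. b \<bullet> x = 0}"
proof (intro subset_antisym subsetI)
  fix x assume "x \<in> {x. b \<bullet> x = 0}"
  \<comment> \<open>The foot of the perpendicular from the origin, used as a base point of the
    hyperplane.\<close>
  moreover define q where "q = b /\<^sub>R (b \<bullet> b)"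
  ultimately have "x + q \<in> hyperplane b" "q \<in> hyperplane b"
    using assms by (simp_all add: hyperplane_def inner_add_right)
  moreover have "x = (x + q) - q" by simp
  ultimately show "x \<in> direction_space (hyperplane b)"
    unfolding direction_space_def by blast
qed (auto simp: direction_space_def hyperplane_def inner_diff_right)

lemma orthonormal_basis_of_exists:
  assumes "subspace S"
  shows "\<exists>B. orthonormal_basis_of S B"
  using orthonormal_basis_subspace[OF assms] unfolding orthonormal_basis_of_def by metis

text \<open>In orthonormal coordinates adapted to \<open>b\<close>, the slice at distance
  \<open>y\<close> from the origin is the section scaled by \<open>t = y * norm b\<close>, hence has
  \<open>t ^ (DIM('a) - 1)\<close> times its measure. Integration over \<open>0 < t \<le> 1\<close>
  gives the factor \<open>1 / (DIM('a) * norm b)\<close>. Only slices with \<open>t > 0\<close> are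
  homothetic to the section, whence the condition \<open>0 < b \<bullet> x\<close>. Working with
  \<open>emeasure\<close> also covers sections of infinite volume.\<close>

lemma emeasure_truncated_cone:
  fixes K :: "'a::euclidean_space set"
  assumes K: "cone K" and [measurable]: "K \<in> sets borel" and b: "b \<noteq> 0"
  shows "emeasure (affine_lborel (hyperplane b)) (K \<inter> hyperplane b) =
    ennreal (DIM('a) * norm b) * emeasure lborel {x \<in> K. 0 < b \<bullet> x \<and> b \<bullet> x \<le> 1}"
proof -
  \<comment> \<open>\<open>p\<close> and \<open>B\<close> repeat the choices made inside
    \<open>affine_lborel\<close>, so that its unfolding can be folded back to them.\<close>
  define p where "p = (SOME p. p \<in> hyperplane b)"
  define B where "B = (SOME B. orthonormal_basis_of (direction_space (hyperplane b)) B)"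
  define u where "u = b /\<^sub>R norm b"
  define C where "C = {x \<in> K. 0 < b \<bullet> x \<and> b \<bullet> x \<le> 1}"
  define E where "E = emeasure (affine_lborel (hyperplane b)) (K \<inter> hyperplane b)"
  have "b /\<^sub>R (b \<bullet> b) \<in> hyperplane b" using b by (simp add: hyperplane_def)
  then have "p \<in> hyperplane b" unfolding p_def by (metis someI_ex)
  then have p: "b \<bullet> p = 1" by (simp add: hyperplane_def)
  have B: "orthonormal_basis_of {x. b \<bullet> x = 0} B"
    unfolding B_def direction_space_hyperplane[OF b]
    by (rule someI_ex[OF orthonormal_basis_of_exists[OF subspace_hyperplane]])
  note fin = orthonormal_basis_of_finite[OF B]
  have span: "span B = {x. b \<bullet> x = 0}" using B by (simp add: orthonormal_basis_of_def)
  then have orth: "b \<bullet> v = 0" if "v \<in> B" for v using that span_base by blast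
  then have orth_sum: "b \<bullet> (\<Sum>v\<in>B. x v *\<^sub>R v) = 0" for x by (simp add: inner_sum_right)
  have bu: "b \<bullet> u = norm b" using b by (simp add: u_def dot_square_norm power2_eq_square)
  have uB: "u \<notin> B" using orth[of u] bu b by auto
  have Bu: "orthonormal_basis_of UNIV (insert u B)"
    unfolding orthonormal_basis_of_def
  proof (intro conjI)
    show "pairwise orthogonal (insert u B)"
      using B orth by (auto simp: orthonormal_basis_of_def pairwise_insert orthogonal_def u_def inner_commute)
    show "\<forall>v\<in>insert u B. norm v = 1"
      using B b by (auto simp: orthonormal_basis_of_def u_def)
    show "span (insert u B) = UNIV"
    proof (intro subset_antisym subset_UNIV subsetI)
      fix x
      have "x - ((b \<bullet> x) / norm b) *\<^sub>R u \<in> span B"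
        using b by (simp add: span inner_diff_right bu)
      then show "x \<in> span (insert u B)" by (auto simp: span_insert)
    qed
  qed
  have card: "Suc (card B) = DIM('a)"
    using orthonormal_basis_of_independent[OF Bu] Bu uB fin
    by (metis card_insert_disjoint dim_UNIV dim_eq_card_independent dim_span orthonormal_basis_of_def)
  have [measurable]: "hyperplane b \<in> sets borel"
    unfolding hyperplane_def by measurable
  have [measurable]: "C \<in> sets borel" unfolding C_def by measurable
  have E_eq: "E = (\<integral>\<^sup>+x. indicator K (p + (\<Sum>v\<in>B. x v *\<^sub>R v)) \<partial>(\<Pi>\<^sub>M v\<in>B. lborel))"
  proof -
    have "E = (\<integral>\<^sup>+x. indicator (K \<inter> hyperplane b) x \<partial>affine_lborel (hyperplane b))"
      unfolding E_def by (rule nn_integral_indicator[symmetric]) (simp add: affine_lborel_def Let_def)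
    also have "\<dots> = (\<integral>\<^sup>+x. indicator (K \<inter> hyperplane b) (p + (\<Sum>v\<in>B. x v *\<^sub>R v)) \<partial>(\<Pi>\<^sub>M v\<in>B. lborel))"
      unfolding affine_lborel_def Let_def p_def[symmetric] B_def[symmetric]
      by (subst nn_integral_distr) auto
    also have "\<dots> = (\<integral>\<^sup>+x. indicator K (p + (\<Sum>v\<in>B. x v *\<^sub>R v)) \<partial>(\<Pi>\<^sub>M v\<in>B. lborel))"
      by (intro nn_integral_cong) (simp add: indicator_def hyperplane_def inner_add_right p orth_sum)
    finally show ?thesis .
  qed
  have scale: "s *\<^sub>R z \<in> C \<longleftrightarrow> z \<in> K" if "0 < s" "s \<le> 1" "b \<bullet> z = 1" for s z
  proof -
    have "inverse s *\<^sub>R (s *\<^sub>R z) = z" "0 \<le> inverse s" using that by simp_all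
    then have "s *\<^sub>R z \<in> K \<longleftrightarrow> z \<in> K"
      using mem_cone[OF K, of z s] mem_cone[OF K, of "s *\<^sub>R z" "inverse s"] that(1)
      by (metis less_imp_le)
    then show ?thesis using that by (simp add: C_def)
  qed
  have slice: "(\<integral>\<^sup>+x. indicator C (y *\<^sub>R u + (\<Sum>v\<in>B. x v *\<^sub>R v)) \<partial>(\<Pi>\<^sub>M v\<in>B. lborel)) =
    ennreal (indicator {0<..1 / norm b} y * (y * norm b) ^ card B) * E" for y
  proof (cases "y \<in> {0<..1 / norm b}")
    case True
    let ?t = "y * norm b"
    have t: "0 < ?t" "?t \<le> 1" using True b by (auto simp: field_simps)
    \<comment> \<open>Both vectors have inner product \<open>t\<close> with \<open>b\<close>.
      Shifting the slice coordinates by this difference and scaling them by \<open>t\<close> turns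
      the slice into \<open>t\<close> times the section through \<open>p\<close>.\<close>
    have "?t *\<^sub>R p - y *\<^sub>R u \<in> span B" by (simp add: span inner_diff_right p bu)
    from nn_integral_linear_combination_affine[OF fin this, of ?t "\<lambda>z. indicator C (y *\<^sub>R u + z)"]
    have "(\<integral>\<^sup>+x. indicator C (y *\<^sub>R u + (\<Sum>v\<in>B. x v *\<^sub>R v)) \<partial>(\<Pi>\<^sub>M v\<in>B. lborel)) =
      ennreal (?t ^ card B) *
        (\<integral>\<^sup>+x. indicator C (?t *\<^sub>R p + ?t *\<^sub>R (\<Sum>v\<in>B. x v *\<^sub>R v)) \<partial>(\<Pi>\<^sub>M v\<in>B. lborel))"
      using t True b by simp
    also have "(\<integral>\<^sup>+x. indicator C (?t *\<^sub>R p + ?t *\<^sub>R (\<Sum>v\<in>B. x v *\<^sub>R v)) \<partial>(\<Pi>\<^sub>M v\<in>B. lborel)) = E"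
      unfolding E_eq scaleR_add_right[symmetric]
      by (intro nn_integral_cong) (simp only: indicator_def scale[OF t] inner_add_right p orth_sum add_0_right)
    finally show ?thesis using True by simp
  next
    case False
    have "y *\<^sub>R u + (\<Sum>v\<in>B. x v *\<^sub>R v) \<notin> C" for x
      using False b by (auto simp: C_def inner_add_right orth_sum bu field_simps zero_less_mult_iff)
    then show ?thesis using False by simp
  qed
  have int: "(\<integral>\<^sup>+y. ennreal (indicator {0<..1 / norm b} y * (y * norm b) ^ card B) \<partial>lborel) =
    ennreal (1 / (DIM('a) * norm b))"
  proof -
    \<comment> \<open>Adding the null set \<open>{0}\<close> gives the closed interval that the
      fundamental theorem of calculus expects.\<close>
    have "(\<integral>\<^sup>+y. ennreal (indicator {0<..1 / norm b} y * (y * norm b) ^ card B) \<partial>lborel) =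
      (\<integral>\<^sup>+y. ennreal ((y * norm b) ^ card B) * indicator {0..1 / norm b} y \<partial>lborel)"
      by (intro nn_integral_cong_AE AE_I[of _ _ "{0}"]) (auto simp: indicator_def)
    also have "\<dots> = ennreal ((1 / norm b * norm b) ^ DIM('a) / (DIM('a) * norm b) -
        (0 * norm b) ^ DIM('a) / (DIM('a) * norm b))"
    proof (rule nn_integral_FTC_Icc[where F = "\<lambda>y. (y * norm b) ^ DIM('a) / (DIM('a) * norm b)"])
      fix y
      show "((\<lambda>y. (y * norm b) ^ DIM('a) / (DIM('a) * norm b)) has_real_derivative (y * norm b) ^ card B)
          (at y)"
        unfolding card[symmetric] using b
        by (auto intro!: derivative_eq_intros simp del: of_nat_Suc power_Suc)
    qed auto
    also have "\<dots> = ennreal (1 / (DIM('a) * norm b))"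
      unfolding card[symmetric] using b by simp
    finally show ?thesis .
  qed
  interpret product_sigma_finite "\<lambda>_::'a. lborel :: real measure" by standard
  have "emeasure lborel C = emeasure (distr (\<Pi>\<^sub>M v\<in>insert u B. lborel) borel
      (\<lambda>f. \<Sum>v\<in>insert u B. f v *\<^sub>R v)) C"
    by (simp only: lborel_eq_distr_orthonormal[OF Bu])
  also have "\<dots> = (\<integral>\<^sup>+x. indicator C x \<partial>(distr (\<Pi>\<^sub>M v\<in>insert u B. lborel) borel
      (\<lambda>f. \<Sum>v\<in>insert u B. f v *\<^sub>R v)))"
    by (rule nn_integral_indicator[symmetric]) simp
  also have "\<dots> = (\<integral>\<^sup>+f. indicator C (\<Sum>v\<in>insert u B. f v *\<^sub>R v) \<partial>(\<Pi>\<^sub>M v\<in>insert u B. lborel))"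
    by (rule nn_integral_distr) measurable
  also have "\<dots> = (\<integral>\<^sup>+y. \<integral>\<^sup>+x. indicator C (\<Sum>v\<in>insert u B. (x(u := y)) v *\<^sub>R v) \<partial>(\<Pi>\<^sub>M v\<in>B. lborel) \<partial>lborel)"
    using fin uB by (intro product_nn_integral_insert_rev) auto
  also have "\<dots> = (\<integral>\<^sup>+y. \<integral>\<^sup>+x. indicator C (y *\<^sub>R u + (\<Sum>v\<in>B. x v *\<^sub>R v)) \<partial>(\<Pi>\<^sub>M v\<in>B. lborel) \<partial>lborel)"
  proof (intro nn_integral_cong arg_cong[where f = "indicator C"])
    fix y and x :: "'a \<Rightarrow> real"
    have "(\<Sum>v\<in>B. (x(u := y)) v *\<^sub>R v) = (\<Sum>v\<in>B. x v *\<^sub>R v)" using uB by (intro sum.cong) auto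
    then show "(\<Sum>v\<in>insert u B. (x(u := y)) v *\<^sub>R v) = y *\<^sub>R u + (\<Sum>v\<in>B. x v *\<^sub>R v)"
      using fin uB by simp
  qed
  also have "\<dots> = (\<integral>\<^sup>+y. ennreal (indicator {0<..1 / norm b} y * (y * norm b) ^ card B) \<partial>lborel) * E"
    unfolding slice by (rule nn_integral_multc) measurable
  finally have "emeasure lborel C = ennreal (1 / (DIM('a) * norm b)) * E" unfolding int .
  then have "ennreal (DIM('a) * norm b) * emeasure lborel C =
      (ennreal (DIM('a) * norm b) * ennreal (1 / (DIM('a) * norm b))) * E"
    by (simp add: mult.assoc)
  also have "ennreal (DIM('a) * norm b) * ennreal (1 / (DIM('a) * norm b)) = 1"
    using b by (subst ennreal_mult'[symmetric]) auto
  finally show ?thesis by (simp add: E_def C_def)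
qed

section \<open>Volume of the truncated orthant and of its base\<close>

lemma emeasure_truncated_orthant:
  fixes b :: "'a::euclidean_space"
  assumes b: "\<And>i. i \<in> Basis \<Longrightarrow> 0 < b \<bullet> i"
  shows "emeasure lborel {x. (\<forall>i\<in>Basis. 0 \<le> x \<bullet> i) \<and> b \<bullet> x \<le> 1} =
    ennreal (1 / (fact DIM('a) * (\<Prod>i\<in>Basis. b \<bullet> i)))" (is "emeasure lborel ?C = _")
proof -
  \<comment> \<open>\<open>T\<close> divides the coordinates by those of \<open>b\<close>, so that
    \<open>b \<bullet> T x\<close> is the coordinate sum of \<open>x\<close> and the preimage of the
    truncated orthant is the standard simplex, of volume \<open>1 / fact DIM('a)\<close>.\<close>
  define T where "T x = (0::'a) + (\<Sum>j\<in>Basis. ((1 / (b \<bullet> j)) * (x \<bullet> j)) *\<^sub>R j)" for x :: 'a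
  have T: "T x \<bullet> i = x \<bullet> i / (b \<bullet> i)" if "i \<in> Basis" for x i
    using that by (simp add: T_def)
  have T_nonneg: "0 \<le> T x \<bullet> i \<longleftrightarrow> 0 \<le> x \<bullet> i" if "i \<in> Basis" for x i
    using b[OF that] by (simp add: T[OF that] zero_le_divide_iff)
  have bT: "b \<bullet> T x = (\<Sum>j\<in>Basis. x \<bullet> j)" for x
  proof -
    have "b \<bullet> j \<noteq> 0" if "j \<in> Basis" for j using b[OF that] by simp
    then show ?thesis unfolding T_def by (simp add: inner_sum_right)
  qed
  have [measurable]: "T \<in> borel \<rightarrow>\<^sub>M borel" unfolding T_def by measurable
  have C[measurable]: "?C \<in> sets borel"
  proof -
    have "?C = (\<Inter>i\<in>Basis. {x. 0 \<le> x \<bullet> i}) \<inter> {x. b \<bullet> x \<le> 1}" by auto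
    also have "closed \<dots>"
      by (intro closed_Int closed_INT ballI closed_Collect_le continuous_intros)
    finally show ?thesis by (rule borel_closed)
  qed
  have "emeasure lborel ?C = emeasure (density (distr lborel borel T)
      (\<lambda>_. ennreal (\<Prod>j\<in>Basis. \<bar>1 / (b \<bullet> j)\<bar>))) ?C"
    by (subst lborel_affine_euclidean[of "\<lambda>j. 1 / (b \<bullet> j)" 0])
      (use b in \<open>auto simp: T_def[abs_def] less_le\<close>)
  also have "\<dots> = ennreal (\<Prod>j\<in>Basis. \<bar>1 / (b \<bullet> j)\<bar>) * emeasure lborel (T -` ?C)"
    by (subst emeasure_density) (auto simp: nn_integral_cmult_indicator emeasure_distr)
  also have "T -` ?C = convex hull (insert 0 Basis)"
    unfolding std_simplex by (auto simp: bT T_nonneg)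
  also have "(\<Prod>j\<in>Basis. \<bar>1 / (b \<bullet> j)\<bar>) = 1 / (\<Prod>j\<in>Basis. b \<bullet> j)"
  proof -
    have "\<bar>1 / (b \<bullet> j)\<bar> = 1 / (b \<bullet> j)" if "j \<in> Basis" for j using b[OF that] by simp
    then show ?thesis by (simp add: prod_dividef)
  qed
  finally show ?thesis
    unfolding emeasure_std_simplex
    using prod_pos[of Basis "\<lambda>i. b \<bullet> i"] b
    by (subst (asm) ennreal_mult'[symmetric]) (auto simp: mult.commute)
qed

lemma inner_Basis_vec_iff: "(\<forall>i\<in>Basis. P (x \<bullet> i)) \<longleftrightarrow> (\<forall>i. P ((x :: real^'n) $ i))"
  by (auto simp: Basis_vec_def inner_axis)

lemma prod_Basis_vec: "(\<Prod>i\<in>Basis. (x :: real^'n) \<bullet> i) = (\<Prod>i\<in>UNIV. x $ i)"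
  by (rule prod.reindex_bij_betw[where h = "\<lambda>i. axis i 1" and S = UNIV and T = Basis and g = "(\<bullet>) x", symmetric,
    unfolded inner_axis inner_real_def mult_1_right])
    (auto simp: bij_betw_def inj_on_def axis_eq_axis Basis_vec_def)

lemma cone_orthant: "cone orthant"
  by (auto simp: cone_def orthant_def)

lemma closed_orthant: "closed orthant"
  unfolding orthant_def by (intro closed_Collect_all closed_Collect_le continuous_intros)

lemma section_volume_orthant:
  fixes b :: "real^'n"
  assumes b: "\<And>i. 0 < b $ i"
  shows "section_volume orthant b = norm b / (fact (CARD('n) - 1) * (\<Prod>i\<in>UNIV. b $ i))"
proof -
  have b0: "b \<noteq> 0" using b by (metis less_irrefl zero_index)
  have prod: "0 < (\<Prod>i\<in>UNIV. b $ i)" using b by (intro prod_pos) auto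
  have pos: "0 < b \<bullet> x" if "x \<in> orthant" "x \<noteq> 0" for x
  proof -
    obtain j where "x $ j \<noteq> 0" using \<open>x \<noteq> 0\<close> by (auto simp: vec_eq_iff)
    then have "0 < b $ j * x $ j" using b that by (auto simp: orthant_def less_le)
    also have "\<dots> \<le> (\<Sum>i\<in>UNIV. b $ i * x $ i)"
      using b that by (intro member_le_sum) (auto simp: orthant_def less_imp_le)
    finally show ?thesis by (simp add: inner_vec_def)
  qed
  \<comment> \<open>On the orthant \<open>b \<bullet> x\<close> vanishes only at the origin, so the
    strict inequality removes a single point, which is a null set.\<close>
  have "emeasure lborel {x \<in> orthant. 0 < b \<bullet> x \<and> b \<bullet> x \<le> 1} =
      emeasure lborel ({x. (\<forall>i\<in>Basis. 0 \<le> x \<bullet> i) \<and> b \<bullet> x \<le> 1} - {0})"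
    using pos by (intro arg_cong[where f = "emeasure lborel"])
      (auto simp: inner_Basis_vec_iff orthant_def)
  also have "\<dots> = emeasure lborel {x. (\<forall>i\<in>Basis. 0 \<le> x \<bullet> i) \<and> b \<bullet> x \<le> 1}"
    by (rule emeasure_Diff_null_set) (auto simp: null_sets_def)
  also have "\<dots> = ennreal (1 / (fact CARD('n) * (\<Prod>i\<in>UNIV. b $ i)))"
    using emeasure_truncated_orthant[of b] b inner_Basis_vec_iff[of "\<lambda>x. 0 < x" b]
    by (simp add: prod_Basis_vec)
  finally have "emeasure (affine_lborel (hyperplane b)) (orthant \<inter> hyperplane b) =
      ennreal (CARD('n) * norm b) * ennreal (1 / (fact CARD('n) * (\<Prod>i\<in>UNIV. b $ i)))"
    by (subst emeasure_truncated_cone[OF cone_orthant borel_closed[OF closed_orthant] b0]) simp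
  also have "\<dots> = ennreal (CARD('n) * norm b * (1 / (fact CARD('n) * (\<Prod>i\<in>UNIV. b $ i))))"
    by (rule ennreal_mult'[symmetric]) simp
  finally have "emeasure (affine_lborel (hyperplane b)) (orthant \<inter> hyperplane b) =
    ennreal (CARD('n) * norm b * (1 / (fact CARD('n) * (\<Prod>i\<in>UNIV. b $ i))))" .
  then have "section_volume orthant b = CARD('n) * norm b * (1 / (fact CARD('n) * (\<Prod>i\<in>UNIV. b $ i)))"
    unfolding section_volume_def measure_def using prod by (simp add: enn2real_ennreal)
  \<comment> \<open>The factor \<open>CARD('n)\<close> from slicing the cone lowers the factorial by
    one.\<close>
  also have "(fact CARD('n) :: real) = CARD('n) * fact (CARD('n) - 1)"
    using fact_reduce[of "CARD('n)", where 'a = real] by simp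
  finally show ?thesis by simp
qed

subsection \<open>Stationary hyperplanes of the orthant\<close>

text \<open>The orthant is self-dual: testing on the unit vectors gives one inclusion, and sums of
  nonnegative products the other.\<close>

lemma interior_dual_orthant:
  "interior (dual_cone (orthant :: (real^'n) set)) = {b. \<forall>i. 0 < b $ i}"
proof -
  have "dual_cone orthant = (orthant :: (real^'n) set)"
  proof (intro subset_antisym subsetI)
    fix y :: "real^'n" assume "y \<in> dual_cone orthant"
    moreover have "axis i 1 \<in> (orthant :: (real^'n) set)" for i
      by (simp add: orthant_def axis_def)
    ultimately have "0 \<le> y \<bullet> axis i 1" for i by (simp add: dual_cone_def)
    then show "y \<in> orthant" by (simp add: orthant_def inner_axis)
  qed (auto simp: dual_cone_def orthant_def inner_vec_def intro!: sum_nonneg)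
  then show ?thesis by (simp add: interior_orthant)
qed

lemma GDERIV_unique:
  assumes "GDERIV f x :> D" and "GDERIV f x :> D'"
  shows "D = D'"
proof -
  have "(\<lambda>h. h \<bullet> D) = (\<lambda>h. h \<bullet> D')"
    using assms has_derivative_unique unfolding gderiv_def by blast
  then have "\<forall>h. h \<bullet> D = h \<bullet> D'" by (simp add: fun_eq_iff)
  then show ?thesis by (simp only: vector_eq_ldot)
qed

lemma section_volume_orthant_pos:
  fixes b :: "real^'n"
  assumes b: "\<And>i. 0 < b $ i"
  shows "0 < section_volume orthant b"
proof -
  have "b \<noteq> 0" using b by (metis less_irrefl zero_index)
  then show ?thesis using b by (simp add: section_volume_orthant prod_pos)
qed

text \<open>The bracket is the logarithmic gradient of the volume formula: \<open>norm\<close>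
  contributes \<open>b $ i / (norm b)\<^sup>2\<close>, and the product in the denominator
  contributes \<open>- 1 / b $ i\<close>.\<close>

lemma GDERIV_section_volume_orthant:
  fixes b :: "real^'n"
  assumes b: "\<And>i. 0 < b $ i"
  shows "GDERIV (section_volume orthant) b :>
    section_volume orthant b *\<^sub>R (\<chi> i. b $ i / (norm b)\<^sup>2 - 1 / b $ i)"
proof -
  define Q where "Q x = fact (CARD('n) - 1) * (\<Prod>i\<in>UNIV. x $ i)" for x :: "real^'n"
  have b0: "b \<noteq> 0" using b by (metis less_irrefl zero_index)
  have bi: "b $ i \<noteq> 0" for i using b[of i] by simp
  have Q: "0 < Q b" using b by (simp add: Q_def prod_pos)
  have dQ: "(Q has_derivative (\<lambda>h. Q b * (\<Sum>i\<in>UNIV. h $ i / b $ i))) (at b)"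
  proof -
    have "((\<lambda>x. \<Prod>i\<in>UNIV. x $ i) has_derivative
        (\<lambda>h. \<Sum>i\<in>UNIV. h $ i * (\<Prod>j\<in>UNIV - {i}. b $ j))) (at b)"
      by (intro has_derivative_prod bounded_linear_imp_has_derivative bounded_linear_vec_nth)
    then have "(Q has_derivative
        (\<lambda>h. fact (CARD('n) - 1) * (\<Sum>i\<in>UNIV. h $ i * (\<Prod>j\<in>UNIV - {i}. b $ j)))) (at b)"
      unfolding Q_def by (rule has_derivative_mult_right)
    moreover have "h $ i * (\<Prod>j\<in>UNIV - {i}. b $ j) = (\<Prod>j\<in>UNIV. b $ j) * (h $ i / b $ i)" for h i
      using bi[of i] by (subst prod.remove[of UNIV i]) auto
    ultimately show ?thesis by (simp add: Q_def sum_distrib_left mult.assoc)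
  qed
  have dN: "(norm has_derivative (\<lambda>h. h \<bullet> sgn b)) (at b)"
    using GDERIV_norm[OF b0] by (simp add: gderiv_def)
  have "((\<lambda>x. norm x / Q x) has_derivative
      (\<lambda>h. (h \<bullet> sgn b * Q b - norm b * (Q b * (\<Sum>i\<in>UNIV. h $ i / b $ i))) / (Q b * Q b))) (at b)"
    using has_derivative_divide'[OF dN dQ] Q by simp
  also have "(\<lambda>h. (h \<bullet> sgn b * Q b - norm b * (Q b * (\<Sum>i\<in>UNIV. h $ i / b $ i))) / (Q b * Q b)) =
      (\<lambda>h. h \<bullet> (section_volume orthant b *\<^sub>R (\<chi> i. b $ i / (norm b)\<^sup>2 - 1 / b $ i)))"
  proof
    fix h :: "real^'n"
    have eq: "h \<bullet> (\<chi> i. b $ i / (norm b)\<^sup>2 - 1 / b $ i) = h \<bullet> b / (norm b)\<^sup>2 - (\<Sum>i\<in>UNIV. h $ i / b $ i)"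
      by (simp add: inner_vec_def right_diff_distrib sum_subtractf sum_divide_distrib)
    show "(h \<bullet> sgn b * Q b - norm b * (Q b * (\<Sum>i\<in>UNIV. h $ i / b $ i))) / (Q b * Q b) =
        h \<bullet> (section_volume orthant b *\<^sub>R (\<chi> i. b $ i / (norm b)\<^sup>2 - 1 / b $ i))"
      unfolding inner_scaleR_right eq section_volume_orthant[OF b] Q_def[symmetric] sgn_div_norm
      using b0 Q by (simp add: power2_eq_square field_simps)
  qed
  finally have "GDERIV (\<lambda>x. norm x / Q x) b :>
      section_volume orthant b *\<^sub>R (\<chi> i. b $ i / (norm b)\<^sup>2 - 1 / b $ i)"
    unfolding gderiv_def .
  \<comment> \<open>The closed formula for \<open>section_volume\<close> was proved for positive
    coordinates only. These form an open set, so the derivative carries over.\<close>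
  moreover have "open {x :: real^'n. \<forall>i. 0 < x $ i}"
    by (metis interior_orthant open_interior)
  ultimately show ?thesis
    unfolding gderiv_def
    by (rule has_derivative_transform_within_open) (use b in \<open>auto simp: Q_def section_volume_orthant\<close>)
qed

section \<open>The root \<open>lambda_root\<close> and the intercepts \<open>c_coeff\<close>\<close>

lemma lambda_root_eqI:
  fixes a :: "real^'n"
  assumes "CARD('n) \<ge> 2" and "a \<in> interior orthant" and "0 \<le> x" and "f_fun a x = 0"
  shows "lambda_root a = x"
proof -
  have "0 \<le> Min (range (\<lambda>i. (b_coeff a i)\<^sup>2))" by (subst Min_ge_iff) auto
  then have "x \<in> f_dom a" using assms(3) unfolding f_dom_def atLeast_iff by linarith
  then show ?thesis using lambda_root(1-3)[OF assms(1,2)] assms(4) by blast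
qed

lemma b_coeff_pos:
  fixes a :: "real^'n"
  assumes "CARD('n) \<ge> 2" and "a \<in> interior orthant"
  shows "0 < b_coeff a i"
  using assms by (simp add: b_coeff_def interior_orthant)

lemma c_coeff_pos:
  fixes a :: "real^'n"
  assumes "CARD('n) \<ge> 2" and "a \<in> interior orthant"
  shows "0 < c_coeff a i"
  using b_coeff_pos[OF assms, of i] lambda_root(4)[OF assms]
  by (simp add: c_coeff_def add_pos_nonneg)

text \<open>\<open>c_coeff a i\<close> is the larger root of
  \<open>t\<^sup>2 - 2 * b_coeff a i * t - lambda_root a\<close>, by the quadratic formula.\<close>

lemma c_coeff_quadratic:
  fixes a :: "real^'n"
  assumes "CARD('n) \<ge> 2" and "a \<in> interior orthant"
  shows "(c_coeff a i)\<^sup>2 = 2 * b_coeff a i * c_coeff a i + lambda_root a"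
proof -
  have "(sqrt ((b_coeff a i)\<^sup>2 + lambda_root a))\<^sup>2 = (b_coeff a i)\<^sup>2 + lambda_root a"
    using lambda_root(4)[OF assms] by (simp add: add_nonneg_nonneg)
  then show ?thesis by (simp add: c_coeff_def power2_eq_square algebra_simps)
qed

lemma sum_b_coeff_div_c_coeff:
  fixes a :: "real^'n"
  assumes "CARD('n) \<ge> 2" and "a \<in> interior orthant"
  shows "(\<Sum>i\<in>UNIV. b_coeff a i / c_coeff a i) = (real CARD('n) - 1) / 2"
  using lambda_root(3)[OF assms] by (simp add: f_fun_def c_coeff_def)

text \<open>The equation \<open>f_fun a (lambda_root a) = 0\<close>, multiplied by
  \<open>2 / (CARD('n) - 1)\<close>, is the condition that the hyperplane contains the given
  point.\<close>

lemma inner_inverse_c_coeff: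
  fixes a :: "real^'n"
  assumes "CARD('n) \<ge> 2" and "a \<in> interior orthant"
  shows "(\<chi> i. 1 / c_coeff a i) \<bullet> a = 1"
proof -
  have "(real CARD('n) - 1) / 2 * ((\<chi> i. 1 / c_coeff a i) \<bullet> a) = (\<Sum>i\<in>UNIV. b_coeff a i / c_coeff a i)"
    by (simp add: inner_vec_def b_coeff_def sum_distrib_left)
  then show ?thesis using assms(1) by (simp add: sum_b_coeff_div_c_coeff[OF assms])
qed

lemma norm_inverse_c_coeff:
  fixes a :: "real^'n"
  assumes "CARD('n) \<ge> 2" and "a \<in> interior orthant"
  shows "norm (\<chi> i. 1 / c_coeff a i) = 1 / sqrt (lambda_root a)"
proof -
  note pos = lambda_root(4)[OF assms]
  have "lambda_root a * (1 / c_coeff a i)\<^sup>2 = 1 - 2 * (b_coeff a i / c_coeff a i)" for i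
  proof -
    have "lambda_root a = (c_coeff a i)\<^sup>2 - 2 * b_coeff a i * c_coeff a i"
      using c_coeff_quadratic[OF assms, of i] by simp
    then show ?thesis
      using c_coeff_pos[OF assms, of i] by (simp add: field_simps power2_eq_square)
  qed
  then have "lambda_root a * (\<Sum>i\<in>UNIV. (1 / c_coeff a i)\<^sup>2) = (\<Sum>i\<in>UNIV. 1 - 2 * (b_coeff a i / c_coeff a i))"
    by (simp only: sum_distrib_left)
  \<comment> \<open>With n for \<open>CARD('n)\<close>, the sum is n - 2 (n - 1) / 2.\<close>
  also have "\<dots> = 1"
    by (simp only: sum_subtractf sum_distrib_left[symmetric] sum_b_coeff_div_c_coeff[OF assms])
      (simp add: field_simps)
  finally have "(\<Sum>i\<in>UNIV. (1 / c_coeff a i)\<^sup>2) = 1 / lambda_root a"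
    using pos by (simp add: field_simps)
  then show ?thesis
    by (simp add: norm_eq_sqrt_inner inner_vec_def power2_eq_square real_sqrt_divide)
qed

lemma stationary_point_orthant_iff:
  fixes a b :: "real^'n"
  assumes n: "CARD('n) \<ge> 2" and a: "a \<in> interior orthant"
  shows "(b \<in> interior (dual_cone orthant) \<and> b \<bullet> a = 1 \<and>
      (\<exists>l. GDERIV (section_volume orthant) b :> l *\<^sub>R a)) \<longleftrightarrow> b = (\<chi> i. 1 / c_coeff a i)"
    (is "?stat \<longleftrightarrow> _")
proof
  assume ?stat
  then obtain l where b: "\<And>i. 0 < b $ i" and ba: "b \<bullet> a = 1"
    and l: "GDERIV (section_volume orthant) b :> l *\<^sub>R a"
    by (auto simp: interior_dual_orthant)
  \<comment> \<open>\<open>\<mu>\<close> is the multiplier normalized by the volume, and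
    \<open>x\<close> is the candidate for \<open>lambda_root a\<close>.\<close>
  define \<mu> where "\<mu> = l / section_volume orthant b"
  define x where "x = 1 / (norm b)\<^sup>2"
  have b0: "b \<noteq> 0" using b by (metis less_irrefl zero_index)
  then have x: "0 < x" by (simp add: x_def)
  note V = section_volume_orthant_pos[OF b]
  have "b $ i * x - 1 / b $ i = \<mu> * a $ i" for i
  proof -
    have "(section_volume orthant b *\<^sub>R (\<chi> i. b $ i / (norm b)\<^sup>2 - 1 / b $ i)) $ i = (l *\<^sub>R a) $ i"
      using GDERIV_unique[OF GDERIV_section_volume_orthant[OF b] l] by simp
    then show ?thesis using V by (simp add: \<mu>_def x_def field_simps)
  qed
  note stat = this
  have "\<mu> = (\<Sum>i\<in>UNIV. b $ i * (\<mu> * a $ i))"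
    using ba by (simp add: inner_vec_def sum_distrib_left[symmetric] mult.left_commute)
  also have "\<dots> = (\<Sum>i\<in>UNIV. b $ i * b $ i * x - 1)"
    using b by (intro sum.cong) (auto simp: stat[symmetric] right_diff_distrib less_imp_neq[THEN not_sym])
  also have "\<dots> = (norm b)\<^sup>2 * x - real CARD('n)"
    by (simp add: sum_subtractf sum_distrib_right[symmetric] inner_vec_def power2_norm_eq_inner)
  also have "\<dots> = 1 - real CARD('n)" using b0 by (simp add: x_def)
  finally have \<mu>: "\<mu> = 1 - real CARD('n)" .
  have eq: "1 / b $ i = b_coeff a i + sqrt ((b_coeff a i)\<^sup>2 + x)" for i
  proof -
    have 1: "1 / b $ i - b $ i * x = 2 * b_coeff a i"
      using stat[of i] by (simp add: \<mu> b_coeff_def algebra_simps)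
    \<comment> \<open>This sign information selects the positive square root when the quadratic
      equation is solved for \<open>1 / b $ i\<close>.\<close>
    then have 2: "2 * (1 / b $ i - b_coeff a i) = 1 / b $ i + b $ i * x" by simp
    have "0 \<le> 1 / b $ i + b $ i * x" using b[of i] x by simp
    then have "0 \<le> 1 / b $ i - b_coeff a i" using 2 by simp
    moreover have "(1 / b $ i - b_coeff a i)\<^sup>2 = (b_coeff a i)\<^sup>2 + x"
    proof -
      have "1 / b $ i * (2 * b_coeff a i) = 1 / b $ i * (1 / b $ i) - x"
        using b[of i] by (simp add: 1[symmetric] right_diff_distrib)
      then show ?thesis by (simp add: power2_eq_square algebra_simps)
    qed
    ultimately show ?thesis using real_sqrt_unique by fastforce
  qed
  \<comment> \<open>By \<open>eq\<close> the denominators in \<open>f_fun a x\<close> are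
    \<open>1 / b $ i\<close>, so the constraint \<open>b \<bullet> a = 1\<close> makes
    \<open>x\<close> a root.\<close>
  have "f_fun a x = (\<Sum>i\<in>UNIV. b_coeff a i * b $ i) - (real CARD('n) - 1) / 2"
    unfolding f_fun_def eq[symmetric] by simp
  also have "(\<Sum>i\<in>UNIV. b_coeff a i * b $ i) = (real CARD('n) - 1) / 2 * (b \<bullet> a)"
    by (simp add: b_coeff_def inner_vec_def sum_distrib_left mult_ac)
  finally have "f_fun a x = 0" using ba by simp
  then have "lambda_root a = x" using x by (intro lambda_root_eqI[OF n a]) auto
  then have "1 / c_coeff a i = b $ i" for i by (simp add: c_coeff_def flip: eq)
  then show "b = (\<chi> i. 1 / c_coeff a i)" by (simp add: vec_eq_iff)
next
  assume b_def: "b = (\<chi> i. 1 / c_coeff a i)"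
  then have b: "0 < b $ i" for i using c_coeff_pos[OF n a, of i] by simp
  have "b $ i / (norm b)\<^sup>2 - 1 / b $ i = (1 - real CARD('n)) * a $ i" for i
  proof -
    have "b $ i / (norm b)\<^sup>2 - 1 / b $ i = lambda_root a / c_coeff a i - c_coeff a i"
      using lambda_root(4)[OF n a] by (simp add: b_def norm_inverse_c_coeff[OF n a] power_divide)
    also have "\<dots> = - 2 * b_coeff a i"
      using c_coeff_quadratic[OF n a, of i] c_coeff_pos[OF n a, of i]
      by (simp add: field_simps power2_eq_square)
    also have "\<dots> = (1 - real CARD('n)) * a $ i" by (simp add: b_coeff_def field_simps)
    finally show ?thesis .
  qed
  then have "section_volume orthant b *\<^sub>R (\<chi> i. b $ i / (norm b)\<^sup>2 - 1 / b $ i) =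
      (section_volume orthant b * (1 - real CARD('n))) *\<^sub>R a"
    by (simp add: vec_eq_iff)
  then have "\<exists>l. GDERIV (section_volume orthant) b :> l *\<^sub>R a"
    using GDERIV_section_volume_orthant[OF b] by metis
  then show ?stat
    using b inner_inverse_c_coeff[OF n a] by (simp add: interior_dual_orthant b_def)
qed

text \<open>The normal vector itself is determined, so the existential over normals in
  \<open>stationary_hyperplane\<close> collapses to a single hyperplane.\<close>

lemma stationary_hyperplane_orthant_iff:
  fixes a :: "real^'n"
  assumes "CARD('n) \<ge> 2" and "a \<in> interior orthant"
  shows "stationary_hyperplane orthant a H \<longleftrightarrow> H = hyperplane (\<chi> i. 1 / c_coeff a i)"
  unfolding stationary_hyperplane_def stationary_point_orthant_iff[OF assms] by blast

section \<open>The simplex cut out by the hyperplane\<close>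

lemma hyperplane_Int_axis_ray:
  fixes b :: "real^'n"
  assumes "0 < b $ i"
  shows "hyperplane b \<inter> {t *\<^sub>R axis i 1 | t. t \<ge> 0} = {(1 / b $ i) *\<^sub>R axis i 1}"
  using assms by (auto simp: hyperplane_def inner_axis field_simps)

text \<open>Injectivity counts the vertices of the simplex; independence follows from orthogonality
  and yields affine independence.\<close>

lemma independent_scaled_axes:
  fixes c :: "'n::finite \<Rightarrow> real"
  assumes c: "\<And>i. c i \<noteq> 0"
  shows "inj (\<lambda>i. c i *\<^sub>R axis i (1::real))" and "independent (range (\<lambda>i. c i *\<^sub>R axis i (1::real)))"
proof -
  show inj: "inj (\<lambda>i. c i *\<^sub>R axis i (1::real))"
    using c by (auto simp: inj_on_def vec_eq_iff axis_def)
  show "independent (range (\<lambda>i. c i *\<^sub>R axis i (1::real)))"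
    using c
    by (intro pairwise_orthogonal_independent)
      (auto simp: pairwise_def orthogonal_def inner_axis_axis)
qed

text \<open>The numbers \<open>b $ i * x $ i\<close> are barycentric coordinates of a point
  \<open>x\<close> of the section: they are nonnegative and sum to
  \<open>b \<bullet> x = 1\<close>.\<close>

lemma convex_hull_scaled_axes:
  fixes b :: "real^'n"
  assumes b: "\<And>i. 0 < b $ i"
  shows "convex hull (range (\<lambda>i. (1 / b $ i) *\<^sub>R axis i 1)) = orthant \<inter> hyperplane b"
    (is "convex hull (range ?A) = _")
proof (intro subset_antisym hull_minimal subsetI)
  show "convex (orthant \<inter> hyperplane b)"
    unfolding hyperplane_def
    by (intro convex_Int convex_hyperplane)
      (auto simp: orthant_def convex_def)
  fix x assume "x \<in> orthant \<inter> hyperplane b"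
  then have x: "\<And>i. 0 \<le> x $ i" and bx: "(\<Sum>i\<in>UNIV. b $ i * x $ i) = 1"
    by (auto simp: orthant_def hyperplane_def inner_vec_def)
  have bi: "b $ i \<noteq> 0" for i using b[of i] by simp
  have "(\<Sum>i\<in>UNIV. (b $ i * x $ i) *\<^sub>R ?A i) \<in> convex hull (range ?A)"
    using b x bx by (intro convex_sum convex_convex_hull) (auto simp: hull_inc less_imp_le)
  also have "(\<Sum>i\<in>UNIV. (b $ i * x $ i) *\<^sub>R ?A i) = x"
    by (simp add: bi basis_expansion scalar_mult_eq_scaleR[symmetric])
  finally show "x \<in> convex hull (range ?A)" .
next
  fix x assume "x \<in> range ?A"
  then obtain i where x: "x = ?A i" by blast
  have "?A i \<in> hyperplane b" using b[of i] by (simp add: hyperplane_def inner_axis)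
  moreover have "?A i \<in> orthant" using b by (simp add: orthant_def axis_def less_imp_le)
  ultimately show "x \<in> orthant \<inter> hyperplane b" by (simp add: x)
qed

text \<open>The vertices are \<open>CARD('n)\<close> affinely independent points of the hyperplane,
  so their affine hull has its full dimension. Hence the measure on the affine hull of the simplex
  is the one that defines \<open>section_volume\<close>.\<close>

lemma affine_hull_scaled_axes:
  fixes b :: "real^'n"
  assumes b: "\<And>i. 0 < b $ i"
  shows "affine hull (range (\<lambda>i. (1 / b $ i) *\<^sub>R axis i 1)) = hyperplane b"
    (is "affine hull (range ?A) = _")
proof (rule affine_dim_equal)
  have b0: "b \<noteq> 0" and bi: "\<And>i. b $ i \<noteq> 0" using b by (metis less_irrefl zero_index)+
  show "affine (hyperplane b)" unfolding hyperplane_def by (rule affine_hyperplane)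
  show "affine hull range ?A \<subseteq> hyperplane b"
    using bi by (intro hull_minimal) (auto simp: hyperplane_def inner_axis affine_hyperplane)
  have "\<not> affine_dependent (range ?A)"
    using independent_scaled_axes(2)[of "\<lambda>i. 1 / b $ i"] bi affine_dependent_imp_dependent by auto
  then have "aff_dim (range ?A) = int (card (range ?A)) - 1"
    using aff_dim_affine_independent by fastforce
  moreover have "card (range ?A) = CARD('n)"
    using independent_scaled_axes(1)[of "\<lambda>i. 1 / b $ i"] bi by (intro card_image) auto
  moreover have "aff_dim (hyperplane b) = int CARD('n) - 1"
    using aff_dim_hyperplane[OF b0, of 1] by (simp add: hyperplane_def)
  ultimately show "aff_dim (affine hull range ?A) = aff_dim (hyperplane b)" by simp
qed auto

theorem proposition6:
  fixes a :: "real^'n"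
  assumes "CARD('n) \<ge> 2" and "a \<in> interior orthant"
  shows "(\<exists>!H. stationary_hyperplane orthant a H) \<and>
    (\<forall>H. stationary_hyperplane orthant a H \<longrightarrow>
      (\<exists>A :: 'n \<Rightarrow> real^'n.
        (\<forall>i. H \<inter> {t *\<^sub>R axis i 1 | t. t \<ge> 0} = {A i}) \<and>
        (\<forall>i. A i = c_coeff a i *\<^sub>R axis i 1) \<and>
        (int CARD('n) - 1) simplex (convex hull (range A)) \<and>
        measure (affine_lborel (affine hull (range A))) (convex hull (range A)) =
          (\<Prod>i\<in>UNIV. c_coeff a i) / (fact (CARD('n) - 1) * sqrt (lambda_root a))))"
proof -
  define b :: "real^'n" where "b = (\<chi> i. 1 / c_coeff a i)"
  define A :: "'n \<Rightarrow> real^'n" where "A i = c_coeff a i *\<^sub>R axis i 1" for i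
  have b: "0 < b $ i" for i using c_coeff_pos[OF assms, of i] by (simp add: b_def)
  have A: "A = (\<lambda>i. (1 / b $ i) *\<^sub>R axis i 1)" by (simp add: A_def b_def fun_eq_iff)
  have c0: "c_coeff a i \<noteq> 0" for i using c_coeff_pos[OF assms, of i] by simp
  have "hyperplane b \<inter> {t *\<^sub>R axis i 1 | t. t \<ge> 0} = {A i}" for i
    using hyperplane_Int_axis_ray[OF b] by (simp add: A)
  moreover have "(int CARD('n) - 1) simplex (convex hull (range A))"
    unfolding simplex_def
  proof (intro exI conjI)
    show "\<not> affine_dependent (range A)"
      using independent_scaled_axes(2)[of "c_coeff a"] c0 affine_dependent_imp_dependent by (auto simp: A_def[abs_def])
    show "int (card (range A)) = int CARD('n) - 1 + 1"
      using independent_scaled_axes(1)[of "c_coeff a"] c0 by (simp add: A_def[abs_def] card_image)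
  qed (rule refl)
  moreover have "measure (affine_lborel (affine hull (range A))) (convex hull (range A)) =
      (\<Prod>i\<in>UNIV. c_coeff a i) / (fact (CARD('n) - 1) * sqrt (lambda_root a))"
  proof -
    \<comment> \<open>The simplex is the whole section, so the volume formula applies with
      \<open>b $ i = 1 / c_coeff a i\<close> and
      \<open>norm b = 1 / sqrt (lambda_root a)\<close>.\<close>
    have "measure (affine_lborel (affine hull (range A))) (convex hull (range A)) = section_volume orthant b"
      unfolding A affine_hull_scaled_axes[OF b] convex_hull_scaled_axes[OF b] section_volume_def ..
    also have "\<dots> = (\<Prod>i\<in>UNIV. c_coeff a i) / (fact (CARD('n) - 1) * sqrt (lambda_root a))"
      unfolding section_volume_orthant[OF b]
      by (simp add: b_def norm_inverse_c_coeff[OF assms] prod_dividef)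
    finally show ?thesis .
  qed
  ultimately show ?thesis
    unfolding stationary_hyperplane_orthant_iff[OF assms] b_def[symmetric]
    by (auto intro!: exI[of _ A] simp: A_def)
qed

end
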